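(* Let $k\ge 1$, let $G_1,\dots,G_k$ be finite simple connected graphs, each on at least two vertices, and let $G=G_1\square\cdots\square G_k$ be their Cartesian product. Then the girth of $E(G)$ is $3$ if and only if the girth of $E(G_i)$ is $3$ for all $i\in\{1,\dots,k\}$.
   Context: For a connected simple graph $G$, $d_G$ is the graph distance and $e_G(v)=\max\{d_G(u,v):u\in V(G)\}$. A vertex $u$ is eccentric to $v$ if $d_G(u,v)=e_G(v)$. The eccentric graph $E(G)$ is the simple graph on vertex set $V(G)$ in which two distinct vertices $u,v$ are adjacent iff $u$ is eccentric to $v$ or $v$ is eccentric to $u$. The girth of a graph is the length of its shortest cycle, with the convention that a graph with no cycles has girth $0$. In the Cartesian product $G_1\square\cdots\square G_k$, the vertices are the $k$-tuples in $V(G_1)\times\cdots\times V(G_k)$, and two tuples are adjacent iff they differ in exactly one coordinate $i$ and their $i$-th coordinates are adjacent in $G_i$. *)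

theory Defs
  imports "Graph_Theory.Graph_Theory" "HOL-Library.FuncSet"
begin

text \<open>
  A finite simple graph is a \<^locale>\<open>pair_graph\<close>: a finite, loop-free, symmetric arc
  relation, so each undirected edge is represented by its two opposite arcs.

  Graph distance is the library's shortest-path distance for unit arc weights;
  \<open>gdist_eq_least_walk_length\<close> below spells it out.
\<close>

definition gdist :: "'a pair_pre_digraph \<Rightarrow> 'a \<Rightarrow> 'a \<Rightarrow> ereal" where
  "gdist G u v = wf_digraph.\<mu> (with_proj G) (\<lambda>_. 1) u v"

definition eccentricity :: "'a pair_pre_digraph \<Rightarrow> 'a \<Rightarrow> ereal" where
  "eccentricity G v = Max {gdist G u v | u. u \<in> pverts G}"

definition eccentric_to :: "'a pair_pre_digraph \<Rightarrow> 'a \<Rightarrow> 'a \<Rightarrow> bool" where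
  "eccentric_to G u v \<longleftrightarrow> gdist G u v = eccentricity G v"

definition eccentric_graph :: "'a pair_pre_digraph \<Rightarrow> 'a pair_pre_digraph" where
  "eccentric_graph G = \<lparr> pverts = pverts G,
     parcs = {(u, v). u \<in> pverts G \<and> v \<in> pverts G \<and> u \<noteq> v \<and>
                      (eccentric_to G u v \<or> eccentric_to G v u)} \<rparr>"

text \<open>
  The library notion of cycle admits the closed walk \<open>u, v, u\<close> along the two arcs of one
  edge. Closed walks of length at least 3 without repeated vertices are exactly the
  cycles of the undirected graph.
\<close>

definition cycle_lengths :: "'a pair_pre_digraph \<Rightarrow> nat set" where
  "cycle_lengths G = {length p | p. pre_digraph.cycle (with_proj G) p \<and> 3 \<le> length p}"

definition girth :: "'a pair_pre_digraph \<Rightarrow> nat" where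
  "girth G = (if cycle_lengths G = {} then 0 else Inf (cycle_lengths G))"

text \<open>
  Tuples are functions on the index set, extensional outside of it. All factors have
  vertices in one common type; this is no restriction, since finite graphs can be
  relabelled, e.g. by natural numbers.
\<close>

definition cart_product :: "'i set \<Rightarrow> ('i \<Rightarrow> 'a pair_pre_digraph) \<Rightarrow> ('i \<Rightarrow> 'a) pair_pre_digraph"
where
  "cart_product I G = \<lparr> pverts = (\<Pi>\<^sub>E i\<in>I. pverts (G i)),
     parcs = {(x, y). x \<in> (\<Pi>\<^sub>E i\<in>I. pverts (G i)) \<and> y \<in> (\<Pi>\<^sub>E i\<in>I. pverts (G i)) \<and>
               (\<exists>i\<in>I. (x i, y i) \<in> parcs (G i) \<and> (\<forall>j\<in>I - {i}. x j = y j))} \<rparr>"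

lemma gdist_eq_least_walk_length:
  assumes "pair_wf_digraph G" and "u \<rightarrow>\<^sup>*\<^bsub>with_proj G\<^esub> v"
  shows "gdist G u v =
    ereal (real (LEAST n. \<exists>p. pre_digraph.awalk (with_proj G) u p v \<and> length p = n))"
proof -
  interpret pair_wf_digraph G by fact
  let ?P = "\<lambda>n. \<exists>p. awalk u p v \<and> length p = n"
  have cost: "awalk_cost (\<lambda>_. 1) p = real (length p)" for p :: "('a \<times> 'a) awalk"
    by (induction p) simp_all
  have "\<exists>p. awalk u p v"
    using assms(2) reachable_awalk by blast
  then have "\<exists>n. ?P n"
    by blast
  then have "?P (LEAST n. ?P n)"
    by (rule LeastI_ex)
  then obtain p where p: "awalk u p v" "length p = (LEAST n. ?P n)"
    by blast
  have "\<mu> (\<lambda>_. 1) u v = ereal (real (length p))"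
  proof (rule antisym)
    show "\<mu> (\<lambda>_. 1) u v \<le> ereal (real (length p))"
      using min_cost_le_walk_cost[OF p(1), of "\<lambda>_. 1"] by (simp add: cost)
    show "ereal (real (length p)) \<le> \<mu> (\<lambda>_. 1) u v"
      unfolding \<mu>_def
    proof (rule INF_greatest)
      fix r assume "r \<in> {r. awalk u r v}"
      then have "?P (length r)"
        by blast
      then have "(LEAST n. ?P n) \<le> length r"
        by (rule Least_le)
      then show "ereal (real (length p)) \<le> ereal (awalk_cost (\<lambda>_. 1) r)"
        by (simp add: cost p(2))
    qed
  qed
  then show ?thesis
    by (simp add: gdist_def p(2))
qed

lemma pair_graph_eccentric_graph:
  assumes "finite (pverts G)"
  shows "pair_graph (eccentric_graph G)"
proof -
  have "parcs (eccentric_graph G) \<subseteq> pverts G \<times> pverts G"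
    by (auto simp: eccentric_graph_def)
  then have "finite (parcs (eccentric_graph G))"
    using assms by (meson finite_SigmaI finite_subset)
  then show ?thesis
    using assms by unfold_locales (auto simp: eccentric_graph_def symmetric_def sym_def)
qed

lemma pair_graph_cart_product:
  assumes "finite I" and "\<And>i. i \<in> I \<Longrightarrow> pair_graph (G i)"
  shows "pair_graph (cart_product I G)"
proof -
  let ?V = "\<Pi>\<^sub>E i\<in>I. pverts (G i)"
  have fin: "finite ?V"
    using assms by (intro finite_PiE) (auto simp: pair_graph_def pair_digraph_def
        pair_fin_digraph_def pair_fin_digraph_axioms_def)
  have "parcs (cart_product I G) \<subseteq> ?V \<times> ?V"
    by (auto simp: cart_product_def)
  then have finA: "finite (parcs (cart_product I G))"
    using fin by (meson finite_SigmaI finite_subset)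
  have irr: "(a, a) \<notin> parcs (G i)" if "i \<in> I" for i a
  proof -
    interpret pair_graph "G i" using assms(2) that .
    show ?thesis by (auto dest: no_loops')
  qed
  have arc_sym: "(b, a) \<in> parcs (G i)" if "i \<in> I" "(a, b) \<in> parcs (G i)" for i a b
  proof -
    interpret pair_graph "G i" using assms(2) that(1) .
    show ?thesis using that(2) by (rule arcs_symmetric)
  qed
  show ?thesis
  proof unfold_locales
    show "finite (pverts (cart_product I G))" "finite (parcs (cart_product I G))"
      using fin finA by (auto simp: cart_product_def)
    show "symmetric (with_proj (cart_product I G))"
      unfolding symmetric_def with_proj_simps
    proof (rule symI)
      fix x y assume "(x, y) \<in> parcs (cart_product I G)"
      then obtain i where "x \<in> ?V" "y \<in> ?V" "i \<in> I" "(x i, y i) \<in> parcs (G i)"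
        "\<forall>j\<in>I - {i}. x j = y j"
        by (auto simp: cart_product_def)
      moreover from this have "(y i, x i) \<in> parcs (G i)" "\<forall>j\<in>I - {i}. y j = x j"
        by (blast intro: arc_sym, simp)
      ultimately show "(y, x) \<in> parcs (cart_product I G)"
        unfolding cart_product_def by simp blast
    qed
    show "fst e \<noteq> snd e" if "e \<in> parcs (cart_product I G)" for e
      using that irr by (cases e) (fastforce simp: cart_product_def)
    show "fst e \<in> pverts (cart_product I G)" "snd e \<in> pverts (cart_product I G)"
      if "e \<in> parcs (cart_product I G)" for e
      using that unfolding cart_product_def by force+
  qed
qed

end

theory Submission
  imports Defs
begin

text \<open>
  Distances in the product are sums of distances in the factors, so \<open>u\<close> is eccentric to \<open>v\<close> in
  the product iff every \<open>u i\<close> is eccentric to \<open>v i\<close>. A triangle in an eccentric graph can be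
  sorted by eccentricity: the distance of two of its vertices is at most both eccentricities and
  equal to one of them, hence equal to the smaller one, so the later vertex is eccentric to the
  earlier one. Sorted triangles are a conjunctive condition and therefore pass between the product
  and the factors coordinatewise. Unsorted, the disjunction in the definition of adjacency would
  obstruct the passage from the factors to the product.
\<close>

section \<open>Distances as natural numbers\<close>

text \<open>The graph distance via powers of the arc relation, which suit induction on length and
  sums over factors; \<open>gdist_eq_hop\<close> links it to \<open>gdist\<close>.\<close>

definition hop :: "'a pair_pre_digraph \<Rightarrow> 'a \<Rightarrow> 'a \<Rightarrow> nat" where
  "hop G u v = (LEAST n. (u, v) \<in> parcs G ^^ n)"

text \<open>The vertex condition matters at length 0: the zeroth power relates every element of the
  type to itself, whereas an empty walk needs a vertex.\<close>

lemma (in pair_wf_digraph) awalk_length_iff_relpow: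
  "(\<exists>p. awalk u p v \<and> length p = n) \<longleftrightarrow> u \<in> pverts G \<and> (u, v) \<in> parcs G ^^ n"
proof (induction n arbitrary: u)
  case 0
  then show ?case by (auto simp: awalk_Nil_iff)
next
  case (Suc n)
  have "(\<exists>p. awalk u p v \<and> length p = Suc n)
      \<longleftrightarrow> (\<exists>w. (u, w) \<in> parcs G \<and> (\<exists>p. awalk w p v \<and> length p = n))"
  proof
    assume "\<exists>p. awalk u p v \<and> length p = Suc n"
    then obtain e p where "awalk u (e # p) v" "length p = n" by (metis length_Suc_conv)
    then show "\<exists>w. (u, w) \<in> parcs G \<and> (\<exists>p. awalk w p v \<and> length p = n)"
      by (cases e) (auto simp: awalk_Cons_iff)
  next
    assume "\<exists>w. (u, w) \<in> parcs G \<and> (\<exists>p. awalk w p v \<and> length p = n)"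
    then obtain w p where "awalk u ((u, w) # p) v" "length p = n"
      by (auto simp: awalk_Cons_iff)
    then show "\<exists>p. awalk u p v \<and> length p = Suc n" by (metis length_Cons)
  qed
  also have "\<dots> \<longleftrightarrow> u \<in> pverts G \<and> (u, v) \<in> parcs G ^^ Suc n"
    unfolding Suc.IH by (meson in_arcsD1 in_arcsD2 relpow_Suc_D2 relpow_Suc_I2)
  finally show ?case .
qed

text \<open>
  Connectedness as existence of walks of some length, because walks in the factors combine to a
  walk in the product whose length is the sum of their lengths.
\<close>

locale walk_connected_graph = pair_graph +
  assumes nonempty: "pverts G \<noteq> {}"
    and walk_exists: "u \<in> pverts G \<Longrightarrow> v \<in> pverts G \<Longrightarrow> \<exists>n. (u, v) \<in> parcs G ^^ n"
begin

lemma relpow_hop: "u \<in> pverts G \<Longrightarrow> v \<in> pverts G \<Longrightarrow> (u, v) \<in> parcs G ^^ hop G u v"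
  unfolding hop_def by (rule LeastI_ex) (rule walk_exists)

lemma hop_le: "(u, v) \<in> parcs G ^^ n \<Longrightarrow> hop G u v \<le> n"
  unfolding hop_def by (rule Least_le)

lemma hop_self: "hop G u u = 0"
  using hop_le[of u u 0] by simp

lemma hop_eq_0_iff: "u \<in> pverts G \<Longrightarrow> v \<in> pverts G \<Longrightarrow> hop G u v = 0 \<longleftrightarrow> u = v"
  using relpow_hop[of u v] by (auto simp: hop_self)

lemma hop_commute:
  assumes "u \<in> pverts G" "v \<in> pverts G"
  shows "hop G u v = hop G v u"
proof -
  have "(v, u) \<in> parcs G ^^ n" if "(u, v) \<in> parcs G ^^ n" for n u v
    using that
  proof (induction n arbitrary: v)
    case (Suc n)
    then obtain w where "(u, w) \<in> parcs G ^^ n" "(w, v) \<in> parcs G" by auto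
    then show ?case using Suc.IH by (blast intro: relpow_Suc_I2 arcs_symmetric)
  qed simp
  then have "(u, v) \<in> parcs G ^^ n \<longleftrightarrow> (v, u) \<in> parcs G ^^ n" for n by blast
  then show ?thesis by (simp add: hop_def)
qed

lemma gdist_eq_hop:
  assumes "u \<in> pverts G" "v \<in> pverts G"
  shows "gdist G u v = ereal (real (hop G u v))"
proof -
  have "u \<rightarrow>\<^sup>*\<^bsub>with_proj G\<^esub> v"
    using walk_exists[OF assms] awalk_length_iff_relpow assms(1) reachable_awalk by blast
  then show ?thesis
    using assms(1) gdist_eq_least_walk_length[OF pair_wf_digraph_axioms] awalk_length_iff_relpow
    by (simp add: hop_def)
qed

lemma finite_gdists: "finite {gdist G u v | u. u \<in> pverts G}"
  using pair_finite_verts by (simp add: setcompr_eq_image)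

lemma gdist_le_eccentricity: "u \<in> pverts G \<Longrightarrow> gdist G u v \<le> eccentricity G v"
  unfolding eccentricity_def using finite_gdists by (intro Max_ge) auto

text \<open>Trades the maximum of extended reals for inequalities between naturals, which can be
  summed over coordinates.\<close>

lemma eccentric_to_iff_hop:
  assumes "u \<in> pverts G" "v \<in> pverts G"
  shows "eccentric_to G u v \<longleftrightarrow> (\<forall>w\<in>pverts G. hop G w v \<le> hop G u v)"
proof -
  have "eccentric_to G u v \<longleftrightarrow> (\<forall>w\<in>pverts G. gdist G w v \<le> gdist G u v)"
    unfolding eccentric_to_def eccentricity_def
    using finite_gdists[of v] nonempty assms(1)
    by (subst eq_commute, subst Max_eq_iff) auto
  then show ?thesis
    using assms by (simp add: gdist_eq_hop)
qed

text \<open>If a vertex were eccentric to itself, all distances to it would be 0 and it would be the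
  only vertex.\<close>

lemma eccentric_to_neq:
  assumes "2 \<le> card (pverts G)" "u \<in> pverts G" "v \<in> pverts G" "eccentric_to G u v"
  shows "u \<noteq> v"
proof
  assume "u = v"
  then have "\<forall>w\<in>pverts G. hop G w v = 0"
    using assms(4) eccentric_to_iff_hop[OF assms(2,3)] by (simp add: hop_self)
  then have "pverts G \<subseteq> {v}"
    using hop_eq_0_iff[OF _ assms(3)] by blast
  from card_mono[OF _ this] assms(1) show False by simp
qed

lemma eccentric_to_if_eccentricity_le:
  assumes "(u, v) \<in> parcs (eccentric_graph G)" "eccentricity G v \<le> eccentricity G u"
  shows "eccentric_to G u v"
proof -
  have "u \<in> pverts G" "v \<in> pverts G" "eccentric_to G u v \<or> eccentric_to G v u"
    using assms(1) by (auto simp: eccentric_graph_def)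
  moreover from this have "gdist G u v \<le> eccentricity G v" "gdist G u v = gdist G v u"
    using gdist_le_eccentricity[of u v] by (auto simp: gdist_eq_hop hop_commute)
  \<comment> \<open>If \<open>eccentric_to G v u\<close>, then e(u) = d(u,v) \<le> e(v) \<le> e(u),
    so equality holds throughout.\<close>
  ultimately show ?thesis
    using assms(2) by (auto simp: eccentric_to_def)
qed

end

text \<open>The library's \<open>connected\<close> speaks about the symmetric closure; here the arcs
  are already symmetric, so directed walks exist.\<close>

lemma (in pair_graph) connected_imp_walk_connected_graph:
  assumes "connected (with_proj G)"
  shows "walk_connected_graph G"
proof
  have "strongly_connected (with_proj G)"
    using assms by (rule symmetric_connected_imp_strongly_connected[OF pair_sym_arcs])
  then show "pverts G \<noteq> {}" "u \<in> pverts G \<Longrightarrow> v \<in> pverts G \<Longrightarrow> \<exists>n. (u, v) \<in> parcs G ^^ n"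
    for u v
    using awalk_length_iff_relpow reachable_awalk unfolding strongly_connected_def
    by (simp, metis with_proj_simps(1))
qed

section \<open>Girth 3 and sorted triangles\<close>

text \<open>All cycle lengths are at least 3 and the default for acyclic graphs is 0, so girth 3
  means that the length 3 is attained.\<close>

lemma (in pair_loopfree_digraph) girth_eq_3_iff:
  "girth G = 3 \<longleftrightarrow>
    (\<exists>x y z. (x, y) \<in> parcs G \<and> (y, z) \<in> parcs G \<and> (z, x) \<in> parcs G)"
proof -
  have "girth G = 3 \<longleftrightarrow> 3 \<in> cycle_lengths G"
  proof
    assume "girth G = 3"
    then show "3 \<in> cycle_lengths G"
      unfolding girth_def by (metis Inf_nat_def1 zero_neq_numeral)
  next
    assume 3: "3 \<in> cycle_lengths G"
    have "Inf (cycle_lengths G) = 3"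
      using 3 by (intro cInf_eq_minimum) (auto simp: cycle_lengths_def)
    then show "girth G = 3"
      using 3 by (auto simp: girth_def)
  qed
  also have "\<dots> \<longleftrightarrow> (\<exists>p. cycle p \<and> length p = 3)"
    by (auto simp: cycle_lengths_def)
  also have "\<dots> \<longleftrightarrow>
      (\<exists>x y z. (x, y) \<in> parcs G \<and> (y, z) \<in> parcs G \<and> (z, x) \<in> parcs G)"
  proof
    assume "\<exists>p. cycle p \<and> length p = 3"
    then show "\<exists>x y z. (x, y) \<in> parcs G \<and> (y, z) \<in> parcs G \<and> (z, x) \<in> parcs G"
      by (auto simp: cycle_def numeral_3_eq_3 length_Suc_conv awalk_Cons_iff awalk_Nil_iff)
        blast
  next
    assume "\<exists>x y z. (x, y) \<in> parcs G \<and> (y, z) \<in> parcs G \<and> (z, x) \<in> parcs G"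
    then obtain x y z where
      arcs: "(x, y) \<in> parcs G" "(y, z) \<in> parcs G" "(z, x) \<in> parcs G" by blast
    \<comment> \<open>Absence of loops makes the three vertices distinct.\<close>
    then have "cycle [(x, y), (y, z), (z, x)]"
      by (auto simp: cycle_def awalk_Cons_iff awalk_Nil_iff dest: in_arcsD1 no_loops')
    then show "\<exists>p. cycle p \<and> length p = 3"
      by (intro exI conjI) auto
  qed
  finally show ?thesis .
qed

text \<open>Distinctness of the vertices is left to \<open>eccentric_to_neq\<close>, so every
  condition can be checked coordinatewise.\<close>

definition sorted_triangle :: "'a pair_pre_digraph \<Rightarrow> 'a \<Rightarrow> 'a \<Rightarrow> 'a \<Rightarrow> bool" where
  "sorted_triangle G x y z \<longleftrightarrow> x \<in> pverts G \<and> y \<in> pverts G \<and> z \<in> pverts G \<and>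
     eccentric_to G y x \<and> eccentric_to G z x \<and> eccentric_to G z y"

lemma (in walk_connected_graph) girth_eccentric_graph_eq_3_iff:
  assumes "2 \<le> card (pverts G)"
  shows "girth (eccentric_graph G) = 3 \<longleftrightarrow> (\<exists>x y z. sorted_triangle G x y z)"
proof -
  interpret E: pair_graph "eccentric_graph G"
    by (rule pair_graph_eccentric_graph) (rule pair_finite_verts)
  let ?A = "parcs (eccentric_graph G)"
  show ?thesis
    unfolding E.girth_eq_3_iff
  proof
    assume "\<exists>x y z. (x, y) \<in> ?A \<and> (y, z) \<in> ?A \<and> (z, x) \<in> ?A"
    then obtain x y z where arcs: "(x, y) \<in> ?A" "(y, z) \<in> ?A" "(z, x) \<in> ?A" by blast
    then have arcs': "(y, x) \<in> ?A" "(z, y) \<in> ?A" "(x, z) \<in> ?A"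
      by (blast intro: E.arcs_symmetric)+
    have sorted: "sorted_triangle G a b c"
      if "(b, a) \<in> ?A" "(c, a) \<in> ?A" "(c, b) \<in> ?A"
        "eccentricity G a \<le> eccentricity G b" "eccentricity G b \<le> eccentricity G c" for a b c
    proof -
      have "eccentric_to G b a" "eccentric_to G c a" "eccentric_to G c b"
        using that by (auto intro: eccentric_to_if_eccentricity_le)
      moreover have "a \<in> pverts G" "b \<in> pverts G" "c \<in> pverts G"
        using that by (auto simp: eccentric_graph_def)
      ultimately show ?thesis by (simp add: sorted_triangle_def)
    qed
    \<comment> \<open>Whatever the outcome of the three comparisons, two of them chain up all three
      vertices, as \<open>sorted\<close> requires.\<close>
    show "\<exists>x y z. sorted_triangle G x y z"
      using sorted arcs arcs'
        linear[of "eccentricity G x" "eccentricity G y"]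
        linear[of "eccentricity G y" "eccentricity G z"]
        linear[of "eccentricity G z" "eccentricity G x"]
      by meson
  next
    assume "\<exists>x y z. sorted_triangle G x y z"
    then obtain x y z where "sorted_triangle G x y z" by blast
    then show "\<exists>x y z. (x, y) \<in> ?A \<and> (y, z) \<in> ?A \<and> (z, x) \<in> ?A"
      using eccentric_to_neq[OF assms]
      by (intro exI[of _ x] exI[of _ y] exI[of _ z])
        (auto simp: sorted_triangle_def eccentric_graph_def)
  qed
qed

section \<open>Walks and distances in the Cartesian product\<close>

lemma sum_fun_upd_remove:
  fixes g :: "'i \<Rightarrow> 'b \<Rightarrow> 'c::comm_monoid_add"
  assumes "finite I" "i \<in> I"
  shows "(\<Sum>j\<in>I. g j ((f(i := a)) j)) = g i a + (\<Sum>j\<in>I - {i}. g j (f j))"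
proof -
  have "(\<Sum>j\<in>I - {i}. g j ((f(i := a)) j)) = (\<Sum>j\<in>I - {i}. g j (f j))"
    by (rule sum.cong) simp_all
  then show ?thesis
    using sum.remove[OF assms, of "\<lambda>j. g j ((f(i := a)) j)"] by simp
qed

locale walk_connected_family =
  fixes I :: "'i set" and G :: "'i \<Rightarrow> 'a pair_pre_digraph"
  assumes finite_index: "finite I"
    and factor: "i \<in> I \<Longrightarrow> walk_connected_graph (G i)"
begin

abbreviation "P \<equiv> cart_product I G"

lemma pverts_P: "pverts P = (\<Pi>\<^sub>E i\<in>I. pverts (G i))"
  by (simp add: cart_product_def)

lemma in_pverts_factor: "x \<in> pverts P \<Longrightarrow> i \<in> I \<Longrightarrow> x i \<in> pverts (G i)"
  by (auto simp: pverts_P)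

lemma fun_upd_in_pverts_P:
  "x \<in> pverts P \<Longrightarrow> i \<in> I \<Longrightarrow> a \<in> pverts (G i) \<Longrightarrow> x(i := a) \<in> pverts P"
  by (auto simp: pverts_P PiE_iff extensional_def)

text \<open>Induction on the total length: some factor walk is nonempty, and its first arc, with the
  other coordinates fixed, is an arc of the product.\<close>

lemma relpow_P_if_factors:
  assumes "x \<in> pverts P" "y \<in> pverts P" "\<And>i. i \<in> I \<Longrightarrow> (x i, y i) \<in> parcs (G i) ^^ m i"
  shows "(x, y) \<in> parcs P ^^ (\<Sum>i\<in>I. m i)"
  using assms
proof (induction "\<Sum>i\<in>I. m i" arbitrary: x m)
  case 0
  then have "x i = y i" if "i \<in> I" for i
    using that finite_index "0.prems"(3)[OF that] by (simp add: sum_eq_0_iff)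
  then have "x = y"
    using 0 by (intro PiE_ext[of x I "\<lambda>i. pverts (G i)"]) (auto simp: pverts_P)
  then show ?case using 0(1)[symmetric] by simp
next
  case (Suc n)
  then obtain i where i: "i \<in> I" "m i \<noteq> 0"
    using finite_index by (metis nat.distinct(1) sum.neutral)
  then obtain l where l: "m i = Suc l" by (cases "m i") auto
  then obtain a where a: "(x i, a) \<in> parcs (G i)" "(a, y i) \<in> parcs (G i) ^^ l"
    using Suc.prems(3)[OF i(1)] relpow_Suc_D2 by metis
  interpret Gi: walk_connected_graph "G i" using factor i(1) .
  let ?x = "x(i := a)" and ?m = "m(i := l)"
  have "a \<in> pverts (G i)" using a(1) by (rule Gi.in_arcsD2)
  then have x': "?x \<in> pverts P" using Suc.prems(1) i(1) by (intro fun_upd_in_pverts_P)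
  have "(x, ?x) \<in> parcs P"
    using Suc.prems(1) x' i(1) a(1) by (auto simp: cart_product_def)
  moreover have n: "n = (\<Sum>i\<in>I. ?m i)"
    using Suc.hyps(2) l sum.remove[OF finite_index i(1), of m]
      sum_fun_upd_remove[OF finite_index i(1), of "\<lambda>_ k. k" m l] by simp
  moreover have "(?x, y) \<in> parcs P ^^ (\<Sum>i\<in>I. ?m i)"
    using n x' Suc.prems a(2) by (intro Suc.hyps(1)) auto
  ultimately show ?case
    using Suc.hyps(2) by (metis relpow_Suc_I2)
qed

text \<open>Each arc of the product moves exactly one coordinate, so \<open>m i\<close> counts the
  arcs that move coordinate \<open>i\<close>.\<close>

lemma factors_if_relpow_P:
  assumes "(x, y) \<in> parcs P ^^ n"
  shows "\<exists>m. (\<forall>i\<in>I. (x i, y i) \<in> parcs (G i) ^^ m i) \<and> (\<Sum>i\<in>I. m i) = n"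
  using assms
proof (induction n arbitrary: y)
  case 0
  then show ?case by (intro exI[of _ "\<lambda>_. 0"]) auto
next
  case (Suc n)
  then obtain w where w: "(x, w) \<in> parcs P ^^ n" "(w, y) \<in> parcs P" by auto
  from Suc.IH[OF w(1)] obtain m where
    m: "\<forall>i\<in>I. (x i, w i) \<in> parcs (G i) ^^ m i" "(\<Sum>i\<in>I. m i) = n" by blast
  from w(2) obtain i where
    i: "i \<in> I" "(w i, y i) \<in> parcs (G i)" "\<forall>j\<in>I - {i}. w j = y j"
    by (auto simp: cart_product_def)
  let ?m = "m(i := Suc (m i))"
  have "(x j, y j) \<in> parcs (G j) ^^ ?m j" if "j \<in> I" for j
    using that m(1) i by (cases "j = i") auto
  moreover have "(\<Sum>j\<in>I. ?m j) = Suc n"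
    using m(2) sum.remove[OF finite_index i(1), of m]
      sum_fun_upd_remove[OF finite_index i(1), of "\<lambda>_ k. k" m "Suc (m i)"] by simp
  ultimately show ?case by blast
qed

lemma relpow_P_sum_hop:
  assumes "x \<in> pverts P" "y \<in> pverts P"
  shows "(x, y) \<in> parcs P ^^ (\<Sum>i\<in>I. hop (G i) (x i) (y i))"
  using assms by (intro relpow_P_if_factors walk_connected_graph.relpow_hop factor)
    (auto dest: in_pverts_factor)

lemma walk_connected_graph_P: "walk_connected_graph P"
proof -
  interpret P: pair_graph P
    using finite_index factor by (intro pair_graph_cart_product) (auto simp: walk_connected_graph_def)
  show ?thesis
  proof
    show "pverts P \<noteq> {}"
      using walk_connected_graph.nonempty[OF factor] by (auto simp: pverts_P PiE_eq_empty_iff)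
  qed (use relpow_P_sum_hop in blast)
qed

sublocale P: walk_connected_graph P
  by (rule walk_connected_graph_P)

text \<open>Shortest factor walks combine to a walk of the product; conversely, a shortest walk of
  the product projects to walks in the factors.\<close>

lemma hop_P:
  assumes "x \<in> pverts P" "y \<in> pverts P"
  shows "hop P x y = (\<Sum>i\<in>I. hop (G i) (x i) (y i))"
proof (rule antisym)
  show "hop P x y \<le> (\<Sum>i\<in>I. hop (G i) (x i) (y i))"
    using assms by (intro P.hop_le relpow_P_sum_hop)
next
  from P.relpow_hop[OF assms] obtain m where
    "\<forall>i\<in>I. (x i, y i) \<in> parcs (G i) ^^ m i" "(\<Sum>i\<in>I. m i) = hop P x y"
    using factors_if_relpow_P by blast
  then show "(\<Sum>i\<in>I. hop (G i) (x i) (y i)) \<le> hop P x y"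
    by (metis (no_types, lifting) sum_mono walk_connected_graph.hop_le factor)
qed

section \<open>Eccentric vertices and triangles in the product\<close>

text \<open>The coordinates vary independently, so a sum of distances is maximal iff each summand
  is.\<close>

lemma eccentric_to_P_iff:
  assumes u: "u \<in> pverts P" and v: "v \<in> pverts P"
  shows "eccentric_to P u v \<longleftrightarrow> (\<forall>i\<in>I. eccentric_to (G i) (u i) (v i))"
proof -
  have factor_iff: "eccentric_to (G i) (u i) (v i) \<longleftrightarrow>
      (\<forall>a\<in>pverts (G i). hop (G i) a (v i) \<le> hop (G i) (u i) (v i))" if "i \<in> I" for i
    using walk_connected_graph.eccentric_to_iff_hop[OF factor] that assms
    by (simp add: in_pverts_factor)
  show ?thesis
    unfolding P.eccentric_to_iff_hop[OF assms]
  proof (intro iffI ballI)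
    fix i assume max: "\<forall>w\<in>pverts P. hop P w v \<le> hop P u v" and i: "i \<in> I"
    show "eccentric_to (G i) (u i) (v i)"
      unfolding factor_iff[OF i]
    proof
      fix a assume "a \<in> pverts (G i)"
      \<comment> \<open>Only coordinate \<open>i\<close> of \<open>u\<close> is changed, so the
        other summands cancel in the comparison.\<close>
      then have w: "u(i := a) \<in> pverts P"
        using u i by (intro fun_upd_in_pverts_P)
      then have "hop P (u(i := a)) v \<le> hop P u v"
        using max by blast
      then show "hop (G i) a (v i) \<le> hop (G i) (u i) (v i)"
        using sum_fun_upd_remove[OF finite_index i, of "\<lambda>j b. hop (G j) b (v j)" u a]
          sum.remove[OF finite_index i, of "\<lambda>j. hop (G j) (u j) (v j)"]
        by (simp only: hop_P[OF w v] hop_P[OF u v])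
    qed
  next
    fix w assume "\<forall>i\<in>I. eccentric_to (G i) (u i) (v i)" "w \<in> pverts P"
    then show "hop P w v \<le> hop P u v"
      using u v by (auto simp: hop_P factor_iff in_pverts_factor intro!: sum_mono)
  qed
qed

lemma sorted_triangle_P_iff:
  assumes "x \<in> pverts P" "y \<in> pverts P" "z \<in> pverts P"
  shows "sorted_triangle P x y z \<longleftrightarrow> (\<forall>i\<in>I. sorted_triangle (G i) (x i) (y i) (z i))"
  using assms by (auto simp: sorted_triangle_def eccentric_to_P_iff in_pverts_factor)

lemma ex_sorted_triangle_P_iff:
  "(\<exists>x y z. sorted_triangle P x y z) \<longleftrightarrow> (\<forall>i\<in>I. \<exists>a b c. sorted_triangle (G i) a b c)"
proof
  assume "\<exists>x y z. sorted_triangle P x y z"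
  then show "\<forall>i\<in>I. \<exists>a b c. sorted_triangle (G i) a b c"
    using sorted_triangle_P_iff by (metis sorted_triangle_def)
next
  assume "\<forall>i\<in>I. \<exists>a b c. sorted_triangle (G i) a b c"
  then obtain x y z where
    xyz: "\<And>i. i \<in> I \<Longrightarrow> sorted_triangle (G i) (x i) (y i) (z i)"
    by metis
  \<comment> \<open>The chosen functions are arbitrary off \<open>I\<close>; restricting them makes
    them extensional, hence vertices of the product.\<close>
  then have "sorted_triangle P (restrict x I) (restrict y I) (restrict z I)"
    by (subst sorted_triangle_P_iff) (auto simp: pverts_P sorted_triangle_def)
  then show "\<exists>x y z. sorted_triangle P x y z" by blast
qed

text \<open>Needed to apply the triangle criterion to the product itself; an empty product would
  have a single vertex.\<close>

lemma card_pverts_P_ge_2: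
  assumes "I \<noteq> {}" "\<And>i. i \<in> I \<Longrightarrow> 2 \<le> card (pverts (G i))"
  shows "2 \<le> card (pverts P)"
proof -
  obtain i where i: "i \<in> I" using assms(1) by blast
  have "card (pverts (G i)) dvd (\<Prod>i\<in>I. card (pverts (G i)))"
    using finite_index i by (rule dvd_prodI)
  moreover have "(\<Prod>i\<in>I. card (pverts (G i))) > 0"
    using assms(2) by (intro prod_pos) force
  ultimately have "card (pverts (G i)) \<le> card (pverts P)"
    using finite_index by (simp add: pverts_P card_PiE dvd_imp_le)
  with assms(2)[OF i] show ?thesis by simp
qed

end

theorem theorem4:
  fixes k :: nat and G :: "nat \<Rightarrow> 'a pair_pre_digraph"
  assumes "1 \<le> k"
    and "\<And>i. i \<in> {1..k} \<Longrightarrow> pair_graph (G i)"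
    and "\<And>i. i \<in> {1..k} \<Longrightarrow> connected (with_proj (G i))"
    and "\<And>i. i \<in> {1..k} \<Longrightarrow> 2 \<le> card (pverts (G i))"
  shows "girth (eccentric_graph (cart_product {1..k} G)) = 3 \<longleftrightarrow>
         (\<forall>i\<in>{1..k}. girth (eccentric_graph (G i)) = 3)"
proof -
  interpret walk_connected_family "{1..k}" G
    using assms(2,3)
    by (intro walk_connected_family.intro pair_graph.connected_imp_walk_connected_graph) auto
  have "2 \<le> card (pverts P)"
    using assms(1,4) by (intro card_pverts_P_ge_2) auto
  then show ?thesis
    using walk_connected_graph.girth_eccentric_graph_eq_3_iff[OF factor assms(4)]
    unfolding P.girth_eccentric_graph_eq_3_iff[OF \<open>2 \<le> card (pverts P)\<close>] ex_sorted_triangle_P_iff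
    by (intro ball_cong) auto
qed

end
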